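(* Let $(Z_\alpha)$ and $(\epsilon_\alpha)$ be nets of normal integrands and non-negative (real) random variables, respectively, with $Z_\alpha,\epsilon_\alpha$ defined on a probability space $(\Omega_\alpha,\mathcal{A}_\alpha,\mathbb{P}_\alpha)$, and let $Z$ be a normal integrand on a probability space $(\Omega,\mathcal{A},\mathbb{P})$. Assume that $$(Z_\alpha,\epsilon_\alpha)\stackrel{\mathcal{D}}{\rightarrow}(Z,0)\quad\text{in }(S\times\mathbb{R}_+,\tau_e\times\mathcal{T}).$$ If for every $\eta>0$ there exists a compact $K\subseteq E$ such that $$\liminf_\alpha\mathbb{P}_\alpha(\{\omega\in\Omega_\alpha:\emptyset\neq A(Z_\alpha(\omega),\epsilon_\alpha(\omega))\subseteq K\})\ge1-\eta$$ and if $\mathbb{P}(\{\omega\in\Omega:\mathrm{Argmin}(Z(\omega))\in\mathbf{F}_{0,1}\})=1$, i.e. $Z$ has at most one minimizing point almost surely, then $$A(Z_\alpha,\epsilon_\alpha)\stackrel{\mathcal{D}}{\rightarrow}\mathrm{Argmin}(Z)\quad\text{in }(\mathcal{F},\tau_F).$$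
   Context: $(E,\mathcal{G})$ is a locally compact second countable Hausdorff space, $\mathcal{F}$ the family of its closed subsets, $\mathcal{K}$ the family of its compact subsets. $S$ is the set of all lower semicontinuous $f:E\to[-\infty,\infty]$; $I_A(f)=\inf_{x\in A}f(x)$ for $A\subseteq E$. The epi-topology $\tau_e$ is the coarsest topology on $S$ for which $I_K$ is lower semicontinuous for all $K\in\mathcal{K}$ and $I_G$ is upper semicontinuous for all $G\in\mathcal{G}$; $\mathcal{B}_e=\sigma(\tau_e)$. A normal integrand on a measurable space $(\Omega,\mathcal{A})$ is an $\mathcal{A}$–$\mathcal{B}_e$ measurable map $Z:\Omega\to S$. $\mathbb{R}_+=[0,\infty)$ and $\mathcal{T}=\{[0,r):0<r\in\mathbb{R}\}\cup\{\emptyset,\mathbb{R}_+\}$ is the left-order topology on $\mathbb{R}_+$; $\tau_e\times\mathcal{T}$ is the product topology. The Fell topology $\tau_F$ on $\mathcal{F}$ is generated by the sets $\{F\in\mathcal{F}:F\cap K=\emptyset\}$, $K\in\mathcal{K}$, and $\{F\in\mathcal{F}:F\cap G\neq\emptyset\}$, $G\in\mathcal{G}$. For $f\in S$, $\epsilon\ge0$: $A(f,\epsilon)=\{t\in E:f(t)\le I_E(f)+\epsilon\}\in\mathcal{F}$, and $\mathrm{Argmin}(f)=A(f,0)=\{t\in E:f(t)=I_E(f)\}$. $\mathbf{F}_{0,1}=\{\emptyset\}\cup\{\{x\}:x\in E\}$. Convergence in distribution $X_\alpha\stackrel{\mathcal{D}}{\rightarrow}X$ in a topological space $(\mathcal{X},\mathcal{O})$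 of a net of random elements (measurable with respect to $\sigma(\mathcal{O})$, possibly defined on different probability spaces) means $\liminf_\alpha\mathbb{P}_\alpha(X_\alpha\in O)\ge\mathbb{P}(X\in O)$ for all $O\in\mathcal{O}$. *)

theory Defs
  imports "HOL-Probability.Probability"
begin

section \<open>Semicontinuity and the epi-topology\<close>

definition lsc_map :: "'a topology \<Rightarrow> ('a \<Rightarrow> ereal) \<Rightarrow> bool" where
  "lsc_map X g \<longleftrightarrow> (\<forall>a. openin X {x \<in> topspace X. a < g x})"

definition usc_map :: "'a topology \<Rightarrow> ('a \<Rightarrow> ereal) \<Rightarrow> bool" where
  "usc_map X g \<longleftrightarrow> (\<forall>a. openin X {x \<in> topspace X. g x < a})"

definition lsc_functions :: "('e::topological_space \<Rightarrow> ereal) set" where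
  "lsc_functions = {f. lsc_map euclidean f}"

text \<open>The infimum over the empty set is \<^term>\<open>\<infinity> :: ereal\<close>.\<close>

definition inf_on :: "'e set \<Rightarrow> ('e \<Rightarrow> ereal) \<Rightarrow> ereal" where
  "inf_on A f = (INF x\<in>A. f x)"

definition epi_topology :: "('e::topological_space \<Rightarrow> ereal) topology" where
  "epi_topology = topology_generated_by
     ({{f \<in> lsc_functions. a < inf_on K f} | K a. compact K} \<union>
      {{f \<in> lsc_functions. inf_on G f < a} | G a. open G})"

text \<open>The generating sets cover \<^term>\<open>lsc_functions\<close>, so that is the underlying space; the next
  three lemmas show that \<^term>\<open>epi_topology\<close> is the coarsest topology on it making the infima
  semicontinuous.\<close>

lemma topspace_epi_topology [simp]:
  "topspace (epi_topology :: ('e::topological_space \<Rightarrow> ereal) topology) = lsc_functions"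
proof
  show "topspace (epi_topology :: ('e \<Rightarrow> ereal) topology) \<subseteq> lsc_functions"
    by (auto simp: epi_topology_def)
  have "openin epi_topology {f \<in> lsc_functions. 0 < inf_on ({} :: 'e set) f}"
    unfolding epi_topology_def
    by (intro topology_generated_by_Basis UnI1 CollectI exI[of _ "{}"] exI[of _ 0]
        conjI refl compact_empty)
  then have "openin epi_topology (lsc_functions :: ('e \<Rightarrow> ereal) set)"
    by (simp add: inf_on_def top_ereal_def)
  then show "lsc_functions \<subseteq> topspace (epi_topology :: ('e \<Rightarrow> ereal) topology)"
    by (rule openin_subset)
qed

lemma epi_topology_semicontinuous:
  "compact K \<Longrightarrow> lsc_map epi_topology (inf_on K)"
  "open G \<Longrightarrow> usc_map epi_topology (inf_on G)"
proof -
  show "compact K \<Longrightarrow> lsc_map epi_topology (inf_on K)"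
    unfolding lsc_map_def topspace_epi_topology
    unfolding epi_topology_def by (intro allI topology_generated_by_Basis) blast
  show "open G \<Longrightarrow> usc_map epi_topology (inf_on G)"
    unfolding usc_map_def topspace_epi_topology
    unfolding epi_topology_def by (intro allI topology_generated_by_Basis) blast
qed

lemma epi_topology_coarsest:
  assumes "topspace T = lsc_functions"
    and "\<And>K. compact K \<Longrightarrow> lsc_map T (inf_on K)"
    and "\<And>G. open G \<Longrightarrow> usc_map T (inf_on G)"
    and "openin epi_topology U"
  shows "openin T U"
proof -
  have "openin T V"
    if "V \<in> {{f \<in> lsc_functions. a < inf_on K f} | K a. compact K} \<union>
              {{f \<in> lsc_functions. inf_on G f < a} | G a. open G}" for V
    using that assms(1-3) unfolding lsc_map_def usc_map_def by force
  with generate_topology_on_coarsest[OF istopology_openin] openin_topology_generated_by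
    assms(4)[unfolded epi_topology_def]
  show ?thesis by blast
qed


section \<open>The left-order topology and the Fell topology\<close>

definition left_order_topology :: "real topology" where
  "left_order_topology = topology (\<lambda>U. U = {} \<or> U = {0..} \<or> (\<exists>r>0. U = {0..<r}))"

lemma openin_left_order_topology:
  "openin left_order_topology U \<longleftrightarrow> U = {} \<or> U = {0..} \<or> (\<exists>r>0. U = {0..<r})"
proof -
  let ?L = "\<lambda>U::real set. U = {} \<or> U = {0..} \<or> (\<exists>r>0. U = {0..<r})"
  have char: "?L U \<longleftrightarrow> U \<subseteq> {0..} \<and> (\<forall>x\<in>U. \<exists>s>x. {0..<s} \<subseteq> U)" for U
  proof
    assume "?L U"
    moreover have "\<exists>s>x. {0..<s} \<subseteq> {0..}" for x :: real
      by (intro exI[of _ "x + 1"]) auto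
    ultimately show "U \<subseteq> {0..} \<and> (\<forall>x\<in>U. \<exists>s>x. {0..<s} \<subseteq> U)"
      by (elim disjE exE conjE) auto
  next
    assume U: "U \<subseteq> {0..} \<and> (\<forall>x\<in>U. \<exists>s>x. {0..<s} \<subseteq> U)"
    show "?L U"
    proof (cases "U = {} \<or> \<not> bdd_above U")
      case True
      have "U = {0..}" if "\<not> bdd_above U"
      proof -
        have "y \<in> U" if y: "0 \<le> y" for y
        proof -
          obtain x where "x \<in> U" "y < x"
            using \<open>\<not> bdd_above U\<close> unfolding bdd_above_def by (meson not_less)
          moreover obtain s where "s > x" "{0..<s} \<subseteq> U" using U \<open>x \<in> U\<close> by blast
          ultimately show ?thesis using y by (intro subsetD[OF \<open>{0..<s} \<subseteq> U\<close>]) auto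
        qed
        then show ?thesis using U by auto
      qed
      with True show ?thesis by auto
    next
      case False
      then have ne: "U \<noteq> {}" and bdd: "bdd_above U" by auto
      have lt: "x < Sup U" if xU: "x \<in> U" for x
      proof -
        obtain s where s: "s > x" "{0..<s} \<subseteq> U" using U xU by blast
        have "(x + s) / 2 \<in> U" using s U xU by (intro subsetD[OF s(2)]) force
        then have "(x + s) / 2 \<le> Sup U" using bdd by (rule cSup_upper)
        then show ?thesis using s(1) by simp
      qed
      have "U = {0..<Sup U}"
      proof
        show "U \<subseteq> {0..<Sup U}" using lt U by auto
        show "{0..<Sup U} \<subseteq> U"
        proof
          fix y assume y: "y \<in> {0..<Sup U}"
          then obtain x where "x \<in> U" "y < x"
            using less_cSup_iff[OF ne bdd] by auto
          moreover obtain s where "s > x" "{0..<s} \<subseteq> U" using U \<open>x \<in> U\<close> by blast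
          ultimately show "y \<in> U" using y by (intro subsetD[OF \<open>{0..<s} \<subseteq> U\<close>]) auto
        qed
      qed
      moreover obtain x where "x \<in> U" using ne by blast
      with lt U have "0 \<le> x" "x < Sup U" by auto
      then have "Sup U > 0" by linarith
      ultimately show ?thesis by blast
    qed
  qed
  have "istopology ?L"
    unfolding istopology_def char
  proof (intro conjI allI impI)
    fix V W :: "real set"
    assume V: "V \<subseteq> {0..} \<and> (\<forall>x\<in>V. \<exists>s>x. {0..<s} \<subseteq> V)"
      and W: "W \<subseteq> {0..} \<and> (\<forall>x\<in>W. \<exists>s>x. {0..<s} \<subseteq> W)"
    show "V \<inter> W \<subseteq> {0..}" using V by auto
    show "\<forall>x\<in>V \<inter> W. \<exists>s>x. {0..<s} \<subseteq> V \<inter> W"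
    proof
      fix x assume "x \<in> V \<inter> W"
      then obtain s t where "s > x" "{0..<s} \<subseteq> V" "t > x" "{0..<t} \<subseteq> W"
        using V W by blast
      then show "\<exists>s>x. {0..<s} \<subseteq> V \<inter> W"
        by (intro exI[of _ "min s t"]) auto
    qed
  next
    fix \<K> :: "real set set"
    assume K: "\<forall>V\<in>\<K>. V \<subseteq> {0..} \<and> (\<forall>x\<in>V. \<exists>s>x. {0..<s} \<subseteq> V)"
    then show "\<Union>\<K> \<subseteq> {0..}" by (intro Union_least) (elim ballE conjE, auto)
    show "\<forall>x\<in>\<Union>\<K>. \<exists>s>x. {0..<s} \<subseteq> \<Union>\<K>"
    proof
      fix x assume "x \<in> \<Union>\<K>"
      then obtain V where "V \<in> \<K>" "x \<in> V" by auto
      moreover from this K obtain s where "s > x" "{0..<s} \<subseteq> V" by meson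
      ultimately show "\<exists>s>x. {0..<s} \<subseteq> \<Union>\<K>"
        by (intro exI[of _ s] conjI subset_trans[OF \<open>{0..<s} \<subseteq> V\<close> Union_upper])
    qed
  qed
  then show ?thesis
    unfolding left_order_topology_def by (simp add: topology_inverse')
qed

definition fell_topology :: "'e::topological_space set topology" where
  "fell_topology = topology_generated_by
     ({{F. closed F \<and> F \<inter> K = {}} | K. compact K} \<union>
      {{F. closed F \<and> F \<inter> G \<noteq> {}} | G. open G})"

lemma topspace_fell_topology [simp]:
  "topspace (fell_topology :: 'e::topological_space set topology) = {F. closed F}"
proof
  show "topspace (fell_topology :: 'e set topology) \<subseteq> {F. closed F}"
    by (auto simp: fell_topology_def)
  have "openin fell_topology {F :: 'e set. closed F \<and> F \<inter> {} = {}}"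
    unfolding fell_topology_def
    by (intro topology_generated_by_Basis UnI1 CollectI exI[of _ "{}"] conjI refl compact_empty)
  then have "openin fell_topology {F :: 'e set. closed F}" by simp
  then show "{F. closed F} \<subseteq> topspace (fell_topology :: 'e set topology)"
    by (rule openin_subset)
qed


section \<open>Random elements and convergence in distribution of nets\<close>

definition borel_sigma :: "'a topology \<Rightarrow> 'a measure" where
  "borel_sigma X = sigma (topspace X) {U. openin X U}"

definition normal_integrand :: "'w measure \<Rightarrow> ('w \<Rightarrow> 'e::topological_space \<Rightarrow> ereal) \<Rightarrow> bool" where
  "normal_integrand M Z \<longleftrightarrow> Z \<in> M \<rightarrow>\<^sub>M borel_sigma epi_topology"

definition directed_set :: "'i set \<Rightarrow> ('i \<Rightarrow> 'i \<Rightarrow> bool) \<Rightarrow> bool" where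
  "directed_set D le \<longleftrightarrow> D \<noteq> {} \<and> reflp_on D le \<and> transp_on D le \<and>
     (\<forall>i\<in>D. \<forall>j\<in>D. \<exists>k\<in>D. le i k \<and> le j k)"

text \<open>The tail filter of a net: limits inferior along a net are taken with respect to it.\<close>

definition net_filter :: "'i set \<Rightarrow> ('i \<Rightarrow> 'i \<Rightarrow> bool) \<Rightarrow> 'i filter" where
  "net_filter D le = (INF i\<in>D. principal {j \<in> D. le i j})"

lemma eventually_net_filter:
  assumes "directed_set D le"
  shows "eventually P (net_filter D le) \<longleftrightarrow> (\<exists>i\<in>D. \<forall>j\<in>D. le i j \<longrightarrow> P j)"
proof -
  have "eventually P (net_filter D le) \<longleftrightarrow>
      (\<exists>i\<in>D. eventually P (principal {j \<in> D. le i j}))"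
    unfolding net_filter_def
  proof (rule eventually_INF_base)
    show "D \<noteq> {}" using assms by (simp add: directed_set_def)
    fix i j assume "i \<in> D" "j \<in> D"
    then obtain k where "k \<in> D" "le i k" "le j k"
      using assms unfolding directed_set_def by blast
    moreover have "transp_on D le" using assms by (simp add: directed_set_def)
    ultimately show "\<exists>k\<in>D. principal {l \<in> D. le k l} \<le>
        inf (principal {l \<in> D. le i l}) (principal {l \<in> D. le j l})"
      using \<open>i \<in> D\<close> \<open>j \<in> D\<close> by (intro bexI[of _ k]) (auto dest: transp_onD)
  qed
  then show ?thesis by (auto simp: eventually_principal)
qed

lemma Liminf_net_filter:
  fixes x :: "'i \<Rightarrow> 'b::complete_lattice"
  assumes "directed_set D le"
  shows "Liminf (net_filter D le) x = (SUP i\<in>D. INF j\<in>{j \<in> D. le i j}. x j)"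
  unfolding Liminf_def
proof (rule antisym)
  show "(SUP P\<in>{P. eventually P (net_filter D le)}. INF j\<in>Collect P. x j)
      \<le> (SUP i\<in>D. INF j\<in>{j \<in> D. le i j}. x j)"
  proof (rule SUP_least)
    fix P assume "P \<in> {P. eventually P (net_filter D le)}"
    then obtain i where "i \<in> D" "\<forall>j\<in>D. le i j \<longrightarrow> P j"
      by (auto simp: eventually_net_filter[OF assms])
    then show "(INF j\<in>Collect P. x j) \<le> (SUP i\<in>D. INF j\<in>{j \<in> D. le i j}. x j)"
      by (intro SUP_upper2[of i] INF_superset_mono) auto
  qed
  show "(SUP i\<in>D. INF j\<in>{j \<in> D. le i j}. x j)
      \<le> (SUP P\<in>{P. eventually P (net_filter D le)}. INF j\<in>Collect P. x j)"
  proof (rule SUP_least)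
    fix i assume "i \<in> D"
    then show "(INF j\<in>{j \<in> D. le i j}. x j)
        \<le> (SUP P\<in>{P. eventually P (net_filter D le)}. INF j\<in>Collect P. x j)"
      by (intro SUP_upper) (auto simp: eventually_net_filter[OF assms])
  qed
qed

text \<open>Being a random element, i.e. measurability, is part of convergence in distribution.\<close>

definition conv_in_distr ::
    "'i set \<Rightarrow> ('i \<Rightarrow> 'i \<Rightarrow> bool) \<Rightarrow> ('i \<Rightarrow> 'w measure) \<Rightarrow> ('i \<Rightarrow> 'w \<Rightarrow> 'a) \<Rightarrow>
     'a topology \<Rightarrow> 'v measure \<Rightarrow> ('v \<Rightarrow> 'a) \<Rightarrow> bool" where
  "conv_in_distr D le M X T N Y \<longleftrightarrow>
     (\<forall>i\<in>D. X i \<in> M i \<rightarrow>\<^sub>M borel_sigma T) \<and> Y \<in> N \<rightarrow>\<^sub>M borel_sigma T \<and>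
     (\<forall>U. openin T U \<longrightarrow>
        Liminf (net_filter D le) (\<lambda>i. ereal (measure (M i) {\<omega> \<in> space (M i). X i \<omega> \<in> U}))
          \<ge> ereal (measure N {\<omega> \<in> space N. Y \<omega> \<in> U}))"


section \<open>Sets of (nearly) minimizing points\<close>

definition near_argmin :: "('e \<Rightarrow> ereal) \<Rightarrow> real \<Rightarrow> 'e set" where
  "near_argmin f \<epsilon> = {t. f t \<le> inf_on UNIV f + ereal \<epsilon>}"

definition argmin_set :: "('e \<Rightarrow> ereal) \<Rightarrow> 'e set" where
  "argmin_set f = {t. f t = inf_on UNIV f}"

lemma near_argmin_0: "near_argmin f 0 = argmin_set f"
  unfolding near_argmin_def argmin_set_def inf_on_def
  by (auto intro: antisym INF_lower simp: zero_ereal_def[symmetric])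

definition empty_or_singleton_sets :: "'e set set" where
  "empty_or_singleton_sets = {{}} \<union> {{x} | x. True}"

end

theory Submission
  imports Defs
begin

text \<open>
  Two facts about the map \<open>(f, \<epsilon>) \<mapsto> near_argmin f \<epsilon>\<close> carry the proof.

  The map is upper semicontinuous: for compact \<open>K\<close> the set of pairs with
  \<open>near_argmin f \<epsilon> \<inter> K = {}\<close> is open in the product of the epi-topology and the left-order
  topology, because for nonempty \<open>K\<close> the condition means
  \<open>inf_on UNIV f + \<epsilon> < inf_on K f\<close>, where the left-hand side is upper and the right-hand side
  lower semicontinuous (\<open>openin_near_argmin_miss\<close>). As the space is locally compact and second
  countable, the events of missing a compact set also determine Fell measurability
  (\<open>measurable_fellI\<close>), so that the random sets in question are random elements.

  Upper semicontinuity gives the lower bound on probabilities for the events of missing a compact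
  set. It says nothing about hitting an open set, and this is where uniqueness and tightness
  enter. Let \<open>U\<close> be Fell-open and \<open>K\<close> compact. If \<open>{x} \<in> U\<close>, then \<open>U\<close> contains every nonempty
  closed subset of some neighbourhood \<open>W\<close> of \<open>x\<close> (\<open>fell_open_contains_small_sets\<close>). A nonempty
  set of near-minimizers that lies in \<open>K\<close> and misses the compact set \<open>K - W\<close> therefore belongs to
  \<open>U\<close>. Thus the event of belonging to \<open>U\<close> can be replaced by one of missing compact sets: the
  union \<open>Q\<close>, over all such \<open>W\<close>, of the open sets of pairs whose near-minimizers miss \<open>K - W\<close>
  (\<open>ex_open_forcing_near_argmin\<close>). Convergence in distribution of the pairs bounds
  the lower limit of the probabilities of \<open>Q\<close>, and by tightness only an arbitrarily small
  probability is lost on passing from \<open>Q\<close> to \<open>U\<close>.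
\<close>

section \<open>The Fell topology\<close>

lemma openin_fell_hit: "open G \<Longrightarrow> openin fell_topology {F. closed F \<and> F \<inter> G \<noteq> {}}"
  unfolding fell_topology_def by (rule topology_generated_by_Basis) blast

text \<open>A finite union of compact sets is compact, so a single compact set to be missed suffices,
  whereas the open sets to be hit cannot be merged.\<close>

lemma fell_open_basic_nbhd:
  fixes U :: "'e::topological_space set set"
  assumes "openin fell_topology U" "F \<in> U"
  obtains K \<G> where "compact K" "finite \<G>" "\<And>G. G \<in> \<G> \<Longrightarrow> open G"
    "F \<inter> K = {}" "\<And>G. G \<in> \<G> \<Longrightarrow> F \<inter> G \<noteq> {}"
    "\<And>F'. closed F' \<Longrightarrow> F' \<inter> K = {} \<Longrightarrow> (\<And>G. G \<in> \<G> \<Longrightarrow> F' \<inter> G \<noteq> {}) \<Longrightarrow> F' \<in> U"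
proof -
  define nbhd where "nbhd F U K \<G> \<longleftrightarrow>
      compact K \<and> finite \<G> \<and> (\<forall>G\<in>\<G>. open G) \<and> F \<inter> K = {} \<and> (\<forall>G\<in>\<G>. F \<inter> G \<noteq> {}) \<and>
      (\<forall>F'. closed F' \<longrightarrow> F' \<inter> K = {} \<longrightarrow> (\<forall>G\<in>\<G>. F' \<inter> G \<noteq> {}) \<longrightarrow> F' \<in> U)"
    for F :: "'e set" and U K \<G>
  have "generate_topology_on
      ({{F. closed F \<and> F \<inter> K = {}} | K. compact K} \<union>
       {{F. closed F \<and> F \<inter> G \<noteq> {}} | G. open G}) U"
    using assms(1) unfolding fell_topology_def openin_topology_generated_by_iff .
  then have "\<forall>F\<in>U. \<exists>K \<G>. nbhd F U K \<G>"
  proof induction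
    case Empty
    show ?case by simp
  next
    case (Int U V)
    show ?case
    proof
      fix F assume "F \<in> U \<inter> V"
      then obtain K \<G> L \<H> where "nbhd F U K \<G>" "nbhd F V L \<H>"
        using Int.IH by blast
      then have "nbhd F (U \<inter> V) (K \<union> L) (\<G> \<union> \<H>)"
        unfolding nbhd_def by (auto simp: Int_Un_distrib)
      then show "\<exists>K \<G>. nbhd F (U \<inter> V) K \<G>" by blast
    qed
  next
    case (UN \<U>)
    show ?case
    proof
      fix F assume "F \<in> \<Union>\<U>"
      then obtain U K \<G> where "U \<in> \<U>" "nbhd F U K \<G>" using UN.IH by blast
      then have "nbhd F (\<Union>\<U>) K \<G>" unfolding nbhd_def by (auto intro!: bexI[of _ U])
      then show "\<exists>K \<G>. nbhd F (\<Union>\<U>) K \<G>" by blast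
    qed
  next
    case (Basis U)
    then consider K where "compact K" "U = {F. closed F \<and> F \<inter> K = {}}"
      | G where "open G" "U = {F. closed F \<and> F \<inter> G \<noteq> {}}" by blast
    then show ?case
    proof cases
      case 1
      then have "nbhd F U K {}" if "F \<in> U" for F using that unfolding nbhd_def by auto
      then show ?thesis by blast
    next
      case 2
      then have "nbhd F U {} {G}" if "F \<in> U" for F using that unfolding nbhd_def by auto
      then show ?thesis by blast
    qed
  qed
  then obtain K \<G> where "nbhd F U K \<G>" using assms(2) by blast
  then show thesis unfolding nbhd_def by (intro that[of K \<G>]) auto
qed

text \<open>The only hitting conditions satisfied by \<open>{x}\<close> are those for neighbourhoods of \<open>x\<close>. Every
  nonempty set that lies inside all of these neighbourhoods hits each of them, so near a singleton
  the hitting conditions turn into inclusions.\<close>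

lemma fell_open_contains_small_sets:
  fixes U :: "'e::t2_space set set"
  assumes "openin fell_topology U" "{x} \<in> U"
  obtains W where "open W" "x \<in> W" "\<And>F. closed F \<Longrightarrow> F \<noteq> {} \<Longrightarrow> F \<subseteq> W \<Longrightarrow> F \<in> U"
proof -
  obtain K \<G> where K: "compact K" and \<G>: "finite \<G>" "\<And>G. G \<in> \<G> \<Longrightarrow> open G"
    and x: "{x} \<inter> K = {}" "\<And>G. G \<in> \<G> \<Longrightarrow> {x} \<inter> G \<noteq> {}"
    and U: "\<And>F'. closed F' \<Longrightarrow> F' \<inter> K = {} \<Longrightarrow> (\<And>G. G \<in> \<G> \<Longrightarrow> F' \<inter> G \<noteq> {}) \<Longrightarrow> F' \<in> U"
    using fell_open_basic_nbhd[OF assms] by metis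
  show thesis
  proof (rule that[of "\<Inter>\<G> - K"])
    show "open (\<Inter>\<G> - K)" using K \<G> by (intro open_Diff open_Inter compact_imp_closed) auto
    show "x \<in> \<Inter>\<G> - K" using x by auto
    show "F \<in> U" if "closed F" "F \<noteq> {}" "F \<subseteq> \<Inter>\<G> - K" for F
      using that by (intro U) blast+
  qed
qed

lemma countable_relatively_compact_basis:
  assumes "locally_compact_space (euclidean :: 'e topology)"
  obtains \<B> :: "'e::{t2_space, second_countable_topology} set set" where "countable \<B>" "\<And>B. B \<in> \<B> \<Longrightarrow> open B"
    "\<And>B. B \<in> \<B> \<Longrightarrow> compact (closure B)"
    "\<And>G x. open G \<Longrightarrow> x \<in> G \<Longrightarrow> \<exists>B\<in>\<B>. x \<in> B \<and> closure B \<subseteq> G"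
proof -
  obtain \<C> :: "'e set set" where \<C>: "countable \<C>" "topological_basis \<C>"
    using ex_countable_basis by blast
  have "Hausdorff_space (euclidean :: 'e topology)"
    unfolding Hausdorff_space_def by (simp add: disjnt_def) (metis hausdorff)
  then have nb: "neighbourhood_base_of (\<lambda>C. compactin euclidean C \<and> closedin euclidean C)
      (euclidean :: 'e topology)"
    using assms locally_compact_Hausdorff_imp_regular_space
      locally_compact_regular_space_neighbourhood_base by blast
  show thesis
  proof (rule that[of "{B \<in> \<C>. compact (closure B)}"])
    show "countable {B \<in> \<C>. compact (closure B)}" using \<C>(1) by simp
    show "open B" if "B \<in> {B \<in> \<C>. compact (closure B)}" for B
      using that \<C>(2) topological_basis_open by blast
    show "compact (closure B)" if "B \<in> {B \<in> \<C>. compact (closure B)}" for B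
      using that by blast
    fix G and x :: 'e assume "open G" "x \<in> G"
    then obtain V C where V: "open V" "compact C" "closed C" "x \<in> V" "V \<subseteq> C" "C \<subseteq> G"
      using nb unfolding neighbourhood_base_of by (auto simp: compactin_euclidean_iff) metis
    obtain B where B: "B \<in> \<C>" "x \<in> B" "B \<subseteq> V"
      using topological_basisE[OF \<C>(2) V(1,4)] by metis
    then have "closure B \<subseteq> C" using V by (intro closure_minimal) auto
    moreover from this have "compact (closure B)"
      using compact_Int_closed[OF V(2) closed_closure[of B]] by (simp add: Int_absorb1)
    ultimately show "\<exists>B\<in>{B \<in> \<C>. compact (closure B)}. x \<in> B \<and> closure B \<subseteq> G"
      using B V by blast
  qed
qed

lemma sets_borel_sigma: "sets (borel_sigma T) = sigma_sets (topspace T) {U. openin T U}"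
  unfolding borel_sigma_def by (rule sets_measure_of) (auto dest: openin_subset)

lemma space_borel_sigma [simp]: "space (borel_sigma T) = topspace T"
  unfolding borel_sigma_def by (rule space_measure_of) (auto dest: openin_subset)

lemma measurable_borel_sigmaD:
  assumes "X \<in> M \<rightarrow>\<^sub>M borel_sigma T" "openin T U"
  shows "{\<omega> \<in> space M. X \<omega> \<in> U} \<in> sets M"
proof -
  have "X -` U \<inter> space M \<in> sets M"
    using assms by (intro measurable_sets[OF assms(1)]) (auto simp: sets_borel_sigma)
  then show ?thesis by (simp add: vimage_def Int_def conj_commute)
qed

text \<open>
  An open set \<open>G\<close> is a countable union of compact sets, and a set hits \<open>G\<close> iff it does not miss all
  of them; hence hitting events are measurable once missing events are. An arbitrary Fell-open
  set may be an uncountable union of basic ones, which is why the basic sets have to be refined to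
  those given by finite subfamilies of a countable base: the compact set to be missed is enlarged
  to a union of closures of base elements, and the open sets to be hit are shrunk to base elements.
\<close>

lemma measurable_fellI:
  fixes X :: "'w \<Rightarrow> 'e::{t2_space, second_countable_topology} set"
  assumes lc: "locally_compact_space (euclidean :: 'e topology)"
    and X_closed: "\<And>\<omega>. \<omega> \<in> space M \<Longrightarrow> closed (X \<omega>)"
    and X_miss: "\<And>K. compact K \<Longrightarrow> {\<omega> \<in> space M. X \<omega> \<inter> K = {}} \<in> sets M"
  shows "X \<in> M \<rightarrow>\<^sub>M borel_sigma fell_topology"
proof -
  obtain \<B> :: "'e set set" where "countable \<B>" and \<B>_open: "\<And>B. B \<in> \<B> \<Longrightarrow> open B"
    and \<B>_compact: "\<And>B. B \<in> \<B> \<Longrightarrow> compact (closure B)"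
    and \<B>: "\<And>G x. open G \<Longrightarrow> x \<in> G \<Longrightarrow> \<exists>B\<in>\<B>. x \<in> B \<and> closure B \<subseteq> G"
    using countable_relatively_compact_basis[OF lc] by metis
  have X_hit: "{\<omega> \<in> space M. X \<omega> \<inter> G \<noteq> {}} \<in> sets M" if "open G" for G
  proof -
    have "{\<omega> \<in> space M. X \<omega> \<inter> G \<noteq> {}} =
        (\<Union>B\<in>{B\<in>\<B>. closure B \<subseteq> G}. space M - {\<omega> \<in> space M. X \<omega> \<inter> closure B = {}})"
      using \<B>[OF that] closure_subset by fast
    also have "\<dots> \<in> sets M"
    proof (rule sets.countable_UN'')
      show "countable {B \<in> \<B>. closure B \<subseteq> G}" using \<open>countable \<B>\<close> by simp
    qed (auto intro!: sets.compl_sets X_miss \<B>_compact)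
    finally show ?thesis .
  qed
  have "X -` U \<inter> space M \<in> sets M" if U: "openin fell_topology U" for U
  proof -
    define basic where "basic = (\<lambda>(\<K>, \<G>). {F :: 'e set. closed F \<and>
        F \<inter> (\<Union>B\<in>\<K>. closure B) = {} \<and> (\<forall>G\<in>\<G>. F \<inter> G \<noteq> {})})"
    define I where "I = {p \<in> Collect (\<lambda>\<K>. finite \<K> \<and> \<K> \<subseteq> \<B>) \<times> Collect (\<lambda>\<G>. finite \<G> \<and> \<G> \<subseteq> \<B>).
        basic p \<subseteq> U}"
    have "countable I"
      unfolding I_def using \<open>countable \<B>\<close> by (simp add: countable_Collect_finite_subset)
    have "\<exists>p\<in>I. F \<in> basic p" if FU: "F \<in> U" for F
    proof -
      have F: "closed F" using FU openin_subset[OF U] by auto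
      obtain K \<G> where K: "compact K" "F \<inter> K = {}"
        and \<G>: "finite \<G>" "\<And>G. G \<in> \<G> \<Longrightarrow> open G" "\<And>G. G \<in> \<G> \<Longrightarrow> F \<inter> G \<noteq> {}"
        and KU: "\<And>F'. closed F' \<Longrightarrow> F' \<inter> K = {} \<Longrightarrow> (\<And>G. G \<in> \<G> \<Longrightarrow> F' \<inter> G \<noteq> {}) \<Longrightarrow> F' \<in> U"
        using fell_open_basic_nbhd[OF U FU] by metis
      have "K \<subseteq> \<Union>{B \<in> \<B>. closure B \<subseteq> - F}" using \<B>[of "- F"] F K(2) by blast
      then obtain \<K> where "\<K> \<subseteq> {B \<in> \<B>. closure B \<subseteq> - F}" "finite \<K>" "K \<subseteq> \<Union>\<K>"
        using compactE[OF K(1), of "{B \<in> \<B>. closure B \<subseteq> - F}"] \<B>_open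
        by (metis (no_types, lifting) mem_Collect_eq)
      moreover have "\<forall>G\<in>\<G>. \<exists>B\<in>\<B>. F \<inter> B \<noteq> {} \<and> B \<subseteq> G"
      proof
        fix G assume "G \<in> \<G>"
        then obtain x where "x \<in> F" "x \<in> G" using \<G>(3) by blast
        then obtain B where "B \<in> \<B>" "x \<in> B" "closure B \<subseteq> G"
          using \<B>[OF \<G>(2)[OF \<open>G \<in> \<G>\<close>]] by metis
        then show "\<exists>B\<in>\<B>. F \<inter> B \<noteq> {} \<and> B \<subseteq> G"
          using \<open>x \<in> F\<close> closure_subset[of B] by (intro bexI[of _ B]) auto
      qed
      then obtain h where h: "\<forall>G\<in>\<G>. h G \<in> \<B> \<and> F \<inter> h G \<noteq> {} \<and> h G \<subseteq> G" by metis
      moreover have "basic (\<K>, h ` \<G>) \<subseteq> U"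
      proof
        fix F' assume F': "F' \<in> basic (\<K>, h ` \<G>)"
        then have "closed F'" and miss: "F' \<inter> (\<Union>B\<in>\<K>. closure B) = {}"
          and hit: "\<And>G. G \<in> \<G> \<Longrightarrow> F' \<inter> h G \<noteq> {}" by (simp_all add: basic_def)
        show "F' \<in> U"
        proof (rule KU)
          show "closed F'" by fact
          have "K \<subseteq> (\<Union>B\<in>\<K>. closure B)"
            by (rule order_trans[OF \<open>K \<subseteq> \<Union>\<K>\<close>]) (auto intro: closure_subset[THEN subsetD])
          with miss show "F' \<inter> K = {}" by (simp only: disjoint_iff subset_iff) metis
          show "F' \<inter> G \<noteq> {}" if "G \<in> \<G>" for G
            using hit[OF that] h that Int_mono[OF order_refl[of F'], of "h G" G] by auto
        qed
      qed
      ultimately show ?thesis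
        using F \<G>(1) by (intro bexI[of _ "(\<K>, h ` \<G>)"]) (auto simp: basic_def I_def)
    qed
    moreover have "basic p \<subseteq> U" if "p \<in> I" for p using that by (simp add: I_def)
    ultimately have "U = (\<Union>p\<in>I. basic p)" by fast
    then have "X -` U \<inter> space M = (\<Union>p\<in>I. X -` basic p \<inter> space M)" by auto
    also have "\<dots> \<in> sets M"
    proof (rule sets.countable_UN''[OF \<open>countable I\<close>])
      fix p assume "p \<in> I"
      then obtain \<K> \<G> where p: "p = (\<K>, \<G>)" "finite \<K>" "\<K> \<subseteq> \<B>" "finite \<G>" "\<G> \<subseteq> \<B>"
        unfolding I_def by auto
      have "X -` basic p \<inter> space M = {\<omega> \<in> space M. X \<omega> \<inter> (\<Union>B\<in>\<K>. closure B) = {}} \<inter>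
          {\<omega> \<in> space M. \<forall>G\<in>\<G>. X \<omega> \<inter> G \<noteq> {}}"
        using X_closed by (auto simp: p(1) basic_def)
      moreover have "compact (\<Union>B\<in>\<K>. closure B)"
        using p \<B>_compact by (intro compact_UN) auto
      moreover have "{\<omega> \<in> space M. \<forall>G\<in>\<G>. X \<omega> \<inter> G \<noteq> {}} \<in> sets M"
        using p \<B>_open by (intro sets.sets_Collect_finite_All X_hit) auto
      ultimately show "X -` basic p \<inter> space M \<in> sets M" using X_miss by auto
    qed
    finally show ?thesis .
  qed
  then show ?thesis
    unfolding borel_sigma_def
    by (intro measurable_measure_of) (auto simp: X_closed dest!: openin_subset)
qed

section \<open>Near-minimizers and the epi-topology\<close>

lemma closed_near_argmin:
  assumes "f \<in> lsc_functions"
  shows "closed (near_argmin f \<epsilon>)"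
proof -
  have "open {t. inf_on UNIV f + ereal \<epsilon> < f t}"
    using assms by (auto simp: lsc_functions_def lsc_map_def)
  moreover have "{t. inf_on UNIV f + ereal \<epsilon> < f t} = - near_argmin f \<epsilon>"
    unfolding near_argmin_def by auto
  ultimately show ?thesis by (simp add: closed_def)
qed

text \<open>This replaces the attainment of the minimum of a lower semicontinuous function on a compact
  set: the open sets \<open>{t. a < f t}\<close> with \<open>a > c\<close> cover \<open>K\<close>, and a finite subcover leaves
  a uniform gap above \<open>c\<close>.\<close>

lemma less_inf_on_compact_iff:
  fixes f :: "'e::topological_space \<Rightarrow> ereal"
  assumes "f \<in> lsc_functions" "compact K" "K \<noteq> {}"
  shows "c < inf_on K f \<longleftrightarrow> (\<forall>t\<in>K. c < f t)"
proof
  assume "c < inf_on K f"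
  then show "\<forall>t\<in>K. c < f t" unfolding inf_on_def using less_INF_D by fastforce
next
  assume c: "\<forall>t\<in>K. c < f t"
  have "open {t. a < f t}" for a
    using assms(1) by (auto simp: lsc_functions_def lsc_map_def)
  moreover have "K \<subseteq> (\<Union>a\<in>{c<..}. {t. a < f t})" using c dense by fastforce
  ultimately obtain A where A: "A \<subseteq> {c<..}" "finite A" "K \<subseteq> (\<Union>a\<in>A. {t. a < f t})"
    using compactE_image[OF assms(2), of "{c<..}" "\<lambda>a. {t. a < f t}"] by metis
  then have "A \<noteq> {}" using assms(3) by auto
  then have "c < Min A" using A by (simp add: subset_iff)
  also have "Min A \<le> inf_on K f"
    unfolding inf_on_def
  proof (rule INF_greatest)
    fix t assume "t \<in> K"
    then obtain a where "a \<in> A" "a < f t" using A by auto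
    then show "Min A \<le> f t" using A(2) by (meson Min_le le_less_trans less_imp_le)
  qed
  finally show "c < inf_on K f" .
qed

text \<open>The real separators keep \<open>x\<close>, \<open>\<epsilon>\<close> and \<open>y\<close> apart, so that openness can be checked in each
  quantity on its own, and they avoid sums of infinite values.\<close>

lemma add_less_iff_separated:
  fixes x y :: ereal
  assumes "0 \<le> \<epsilon>"
  shows "x + ereal \<epsilon> < y \<longleftrightarrow> (\<exists>b r. x < ereal b \<and> \<epsilon> < r \<and> ereal (b + r) < y)"
proof
  assume "x + ereal \<epsilon> < y"
  then obtain c where c: "x + ereal \<epsilon> < ereal c" "ereal c < y" using ereal_dense2 by blast
  then have "x < ereal (c - \<epsilon>)" by (cases x) auto
  then obtain b where b: "x < ereal b" "ereal b < ereal (c - \<epsilon>)" using ereal_dense2 by blast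
  then show "\<exists>b r. x < ereal b \<and> \<epsilon> < r \<and> ereal (b + r) < y"
    using c by (intro exI[of _ b] exI[of _ "c - b"]) auto
next
  assume "\<exists>b r. x < ereal b \<and> \<epsilon> < r \<and> ereal (b + r) < y"
  then obtain b r where "x < ereal b" "\<epsilon> < r" "ereal (b + r) < y" by blast
  then show "x + ereal \<epsilon> < y" by (cases x; cases y) auto
qed

text \<open>For \<open>K = {}\<close> the set is the whole space. The characterization by infima cannot be used there:
  it fails when \<open>f\<close> is constantly \<open>\<infinity>\<close>.\<close>

lemma openin_near_argmin_miss:
  fixes K :: "'e::topological_space set"
  assumes "compact K"
  shows "openin (prod_topology epi_topology left_order_topology)
    {(f, \<epsilon>). f \<in> lsc_functions \<and> 0 \<le> \<epsilon> \<and> near_argmin f \<epsilon> \<inter> K = {}}"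
    (is "openin ?T ?miss")
proof (cases "K = {}")
  case True
  have "topspace left_order_topology = {0..}"
    by (intro antisym openin_subset)
      (auto simp: topspace_def openin_left_order_topology)
  then have "?miss = topspace ?T" using True by auto
  then show ?thesis by (metis openin_topspace)
next
  case False
  define rect where "rect b r = ({f \<in> lsc_functions. inf_on UNIV f < ereal b} \<inter>
      {f \<in> lsc_functions. ereal (b + r) < inf_on K f}) \<times> {0..<r}" for b r
  have "near_argmin f \<epsilon> \<inter> K = {} \<longleftrightarrow>
      (\<exists>b r. inf_on UNIV f < ereal b \<and> \<epsilon> < r \<and> ereal (b + r) < inf_on K f)"
    if "f \<in> lsc_functions" "0 \<le> \<epsilon>" for f \<epsilon>
  proof -
    have "near_argmin f \<epsilon> \<inter> K = {} \<longleftrightarrow> (\<forall>t\<in>K. inf_on UNIV f + ereal \<epsilon> < f t)"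
      by (auto simp: near_argmin_def not_le[symmetric])
    then show ?thesis
      using less_inf_on_compact_iff[OF that(1) assms False] add_less_iff_separated[OF that(2)]
      by blast
  qed
  then have "(f, \<epsilon>) \<in> ?miss \<longleftrightarrow> (\<exists>b r. (f, \<epsilon>) \<in> rect b r)" for f \<epsilon>
    by (cases "f \<in> lsc_functions \<and> 0 \<le> \<epsilon>") (auto simp: rect_def)
  then have "?miss = (\<Union>b. \<Union>r. rect b r)"
    by (intro set_eqI) (simp add: split_paired_all del: mem_Collect_eq)
  moreover have "openin ?T (rect b r)" for b r
  proof -
    have "usc_map epi_topology (inf_on (UNIV :: 'e set))"
      by (rule epi_topology_semicontinuous(2)[OF open_UNIV])
    then have "openin epi_topology {f \<in> lsc_functions. inf_on (UNIV :: 'e set) f < ereal b}"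
      by (simp add: usc_map_def)
    moreover have "openin epi_topology {f \<in> lsc_functions. ereal (b + r) < inf_on K f}"
      using epi_topology_semicontinuous(1)[OF assms] unfolding lsc_map_def topspace_epi_topology by blast
    moreover have "openin left_order_topology {0..<r}"
      by (cases "0 < r") (auto simp: openin_left_order_topology)
    ultimately show ?thesis
      unfolding rect_def openin_prod_Times_iff by blast
  qed
  ultimately show ?thesis by (auto intro!: openin_Union)
qed

lemma measurable_near_argmin:
  fixes Z :: "'w \<Rightarrow> 'e::{t2_space, second_countable_topology} \<Rightarrow> ereal"
  assumes lc: "locally_compact_space (euclidean :: 'e topology)"
    and meas: "(\<lambda>\<omega>. (Z \<omega>, \<epsilon> \<omega>)) \<in> M \<rightarrow>\<^sub>M borel_sigma (prod_topology epi_topology left_order_topology)"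
  shows "(\<lambda>\<omega>. near_argmin (Z \<omega>) (\<epsilon> \<omega>)) \<in> M \<rightarrow>\<^sub>M borel_sigma fell_topology"
proof (rule measurable_fellI[OF lc])
  have top: "Z \<omega> \<in> lsc_functions \<and> 0 \<le> \<epsilon> \<omega>" if "\<omega> \<in> space M" for \<omega>
    using measurable_space[OF meas that]
    by (auto simp: topspace_def[of left_order_topology] openin_left_order_topology)
  then show "closed (near_argmin (Z \<omega>) (\<epsilon> \<omega>))" if "\<omega> \<in> space M" for \<omega>
    using that closed_near_argmin by blast
  fix K :: "'e set" assume "compact K"
  from measurable_borel_sigmaD[OF meas openin_near_argmin_miss[OF this]]
  show "{\<omega> \<in> space M. near_argmin (Z \<omega>) (\<epsilon> \<omega>) \<inter> K = {}} \<in> sets M"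
    by (rule back_subst[of "\<lambda>A. A \<in> sets M"]) (use top in auto)
qed

text \<open>
  This transfers a Fell-open set \<open>U\<close> to the space of pairs, on condition that the set of
  near-minimizers is nonempty and contained in \<open>K\<close>. The set \<open>Q\<close> collects the pairs whose
  near-minimizers miss \<open>K - W\<close> for some open \<open>W\<close> so small that its nonempty closed subsets
  all belong to \<open>U\<close>.
\<close>

lemma ex_open_forcing_near_argmin:
  fixes U :: "'e::t2_space set set"
  assumes U: "openin fell_topology U" and K: "compact K"
  obtains Q where "openin (prod_topology epi_topology left_order_topology) Q"
    "\<And>f. f \<in> lsc_functions \<Longrightarrow> argmin_set f \<in> U \<Longrightarrow> argmin_set f \<in> empty_or_singleton_sets
      \<Longrightarrow> (f, 0) \<in> Q"
    "\<And>f \<epsilon>. (f, \<epsilon>) \<in> Q \<Longrightarrow> near_argmin f \<epsilon> \<noteq> {} \<Longrightarrow> near_argmin f \<epsilon> \<subseteq> K \<Longrightarrow> near_argmin f \<epsilon> \<in> U"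
proof -
  define \<W> where "\<W> = {W. open W \<and> (\<forall>F. closed F \<longrightarrow> F \<noteq> {} \<longrightarrow> F \<subseteq> W \<longrightarrow> F \<in> U)}"
  define Q where "Q = (\<Union>W\<in>\<W>.
    {(f, \<epsilon>). f \<in> lsc_functions \<and> 0 \<le> \<epsilon> \<and> near_argmin f \<epsilon> \<inter> (K - W) = {}})"
  show thesis
  proof (rule that)
    show "openin (prod_topology epi_topology left_order_topology) Q"
      unfolding Q_def
      by (intro openin_Union) (auto simp: \<W>_def intro!: openin_near_argmin_miss compact_diff K)
  next
    fix f assume f: "f \<in> lsc_functions" "argmin_set f \<in> U"
      "argmin_set f \<in> empty_or_singleton_sets"
    then have "\<exists>W\<in>\<W>. argmin_set f \<subseteq> W"
    proof (cases "argmin_set f = {}")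
      case True
      \<comment> \<open>The empty neighbourhood qualifies vacuously, so an empty set of minimizers does no harm.\<close>
      have "{} \<in> \<W>" by (simp add: \<W>_def)
      then show ?thesis by (rule bexI[rotated]) (simp add: True)
    next
      case False
      then obtain x where x: "argmin_set f = {x}"
        using f by (auto simp: empty_or_singleton_sets_def)
      with f(2) have "{x} \<in> U" by simp
      then obtain W where "open W" "x \<in> W"
        and "\<And>F. closed F \<Longrightarrow> F \<noteq> {} \<Longrightarrow> F \<subseteq> W \<Longrightarrow> F \<in> U"
        by (rule fell_open_contains_small_sets[OF U]) blast
      then have "W \<in> \<W>" by (simp add: \<W>_def)
      then show ?thesis by (rule bexI[rotated]) (simp add: x \<open>x \<in> W\<close>)
    qed
    then obtain W where W: "W \<in> \<W>" "argmin_set f \<subseteq> W" by blast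
    then have "argmin_set f \<inter> (K - W) = {}" by blast
    with W(1) f(1) show "(f, 0) \<in> Q" unfolding Q_def by (intro UN_I) (simp_all add: near_argmin_0)
  next
    fix f \<epsilon> assume "(f, \<epsilon>) \<in> Q" "near_argmin f \<epsilon> \<noteq> {}" "near_argmin f \<epsilon> \<subseteq> K"
    then obtain W where "W \<in> \<W>" "f \<in> lsc_functions" "near_argmin f \<epsilon> \<subseteq> W"
      unfolding Q_def by (elim UN_E) auto
    with \<open>near_argmin f \<epsilon> \<noteq> {}\<close> closed_near_argmin[of f \<epsilon>] show "near_argmin f \<epsilon> \<in> U"
      unfolding \<W>_def by simp
  qed
qed

section \<open>Convergence in distribution\<close>

lemma (in prob_space) prob_Int_ge:
  assumes "A \<in> events" "B \<in> events"
  shows "prob A + prob B - 1 \<le> prob (A \<inter> B)"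
proof -
  have "prob A \<le> prob ((A \<inter> B) \<union> (space M - B))"
    using assms sets.sets_into_space by (intro finite_measure_mono) auto
  also have "\<dots> \<le> prob (A \<inter> B) + prob (space M - B)"
    using assms by (intro measure_Un_le) auto
  finally show ?thesis using prob_compl[OF assms(2)] by simp
qed

text \<open>Measurability of \<open>S\<close> follows from \<open>prob S = 1\<close>, and a nonmeasurable \<open>A\<close> has probability \<open>0\<close>,
  since the measure of a set outside the \<open>\<sigma>\<close>-algebra is \<open>0\<close>.\<close>

lemma (in prob_space) prob_le_if_almost_subset:
  assumes "prob S = 1" "B \<in> events" "A \<inter> S \<subseteq> B"
  shows "prob A \<le> prob B"
proof (cases "A \<in> events")
  case True
  have "S \<in> events" using assms(1) measure_notin_sets by fastforce
  then have "prob A \<le> prob (A \<inter> S)" using prob_Int_ge[OF True, of S] assms(1) by simp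
  also have "\<dots> \<le> prob B" using assms by (intro finite_measure_mono) auto
  finally show ?thesis .
qed (simp add: measure_notin_sets)

theorem theorem6:
  fixes D :: "'i set" and le :: "'i \<Rightarrow> 'i \<Rightarrow> bool"
    and M :: "'i \<Rightarrow> 'w measure" and N :: "'v measure"
    and Z\<^sub>\<alpha> :: "'i \<Rightarrow> 'w \<Rightarrow> 'e::{t2_space, second_countable_topology} \<Rightarrow> ereal"
    and \<epsilon>\<^sub>\<alpha> :: "'i \<Rightarrow> 'w \<Rightarrow> real"
    and Z :: "'v \<Rightarrow> 'e \<Rightarrow> ereal"
  assumes "locally_compact_space (euclidean :: 'e topology)"
    and "directed_set D le"
    and "\<And>\<alpha>. \<alpha> \<in> D \<Longrightarrow> prob_space (M \<alpha>)"
    and "prob_space N"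
    and "\<And>\<alpha>. \<alpha> \<in> D \<Longrightarrow> normal_integrand (M \<alpha>) (Z\<^sub>\<alpha> \<alpha>)"
    and "\<And>\<alpha>. \<alpha> \<in> D \<Longrightarrow> \<epsilon>\<^sub>\<alpha> \<alpha> \<in> borel_measurable (M \<alpha>)"
    and "\<And>\<alpha> \<omega>. \<alpha> \<in> D \<Longrightarrow> \<omega> \<in> space (M \<alpha>) \<Longrightarrow> 0 \<le> \<epsilon>\<^sub>\<alpha> \<alpha> \<omega>"
    and "normal_integrand N Z"
    and "conv_in_distr D le M (\<lambda>\<alpha> \<omega>. (Z\<^sub>\<alpha> \<alpha> \<omega>, \<epsilon>\<^sub>\<alpha> \<alpha> \<omega>))
           (prod_topology epi_topology left_order_topology) N (\<lambda>\<omega>. (Z \<omega>, 0))"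
    and "\<And>\<eta>::real. \<eta> > 0 \<Longrightarrow> \<exists>K. compact K \<and>
           Liminf (net_filter D le) (\<lambda>\<alpha>. ereal (measure (M \<alpha>)
             {\<omega> \<in> space (M \<alpha>). near_argmin (Z\<^sub>\<alpha> \<alpha> \<omega>) (\<epsilon>\<^sub>\<alpha> \<alpha> \<omega>) \<noteq> {} \<and>
                                near_argmin (Z\<^sub>\<alpha> \<alpha> \<omega>) (\<epsilon>\<^sub>\<alpha> \<alpha> \<omega>) \<subseteq> K})) \<ge> ereal (1 - \<eta>)"
    and "measure N {\<omega> \<in> space N. argmin_set (Z \<omega>) \<in> empty_or_singleton_sets} = 1"
  shows "conv_in_distr D le M (\<lambda>\<alpha> \<omega>. near_argmin (Z\<^sub>\<alpha> \<alpha> \<omega>) (\<epsilon>\<^sub>\<alpha> \<alpha> \<omega>))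
           fell_topology N (\<lambda>\<omega>. argmin_set (Z \<omega>))"
proof -
  let ?T = "prod_topology epi_topology left_order_topology :: (('e \<Rightarrow> ereal) \<times> real) topology"
  let ?A = "\<lambda>\<alpha> \<omega>. near_argmin (Z\<^sub>\<alpha> \<alpha> \<omega>) (\<epsilon>\<^sub>\<alpha> \<alpha> \<omega>)"
  note conv = assms(9)[unfolded conv_in_distr_def]
  have meas: "(\<lambda>\<omega>. (Z\<^sub>\<alpha> \<alpha> \<omega>, \<epsilon>\<^sub>\<alpha> \<alpha> \<omega>)) \<in> M \<alpha> \<rightarrow>\<^sub>M borel_sigma ?T" if "\<alpha> \<in> D" for \<alpha>
    using conv that by blast
  have meas0: "(\<lambda>\<omega>. (Z \<omega>, 0)) \<in> N \<rightarrow>\<^sub>M borel_sigma ?T" using conv by blast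
  have measA: "?A \<alpha> \<in> M \<alpha> \<rightarrow>\<^sub>M borel_sigma fell_topology" if "\<alpha> \<in> D" for \<alpha>
    using measurable_near_argmin[OF assms(1) meas[OF that]] .
  have lsc: "Z \<omega> \<in> lsc_functions" if "\<omega> \<in> space N" for \<omega>
    using measurable_space[OF meas0 that] by simp
  show ?thesis
    unfolding conv_in_distr_def
  proof (intro conjI ballI allI impI)
    show "?A \<alpha> \<in> M \<alpha> \<rightarrow>\<^sub>M borel_sigma fell_topology" if "\<alpha> \<in> D" for \<alpha>
      using measA[OF that] .
    show "(\<lambda>\<omega>. argmin_set (Z \<omega>)) \<in> N \<rightarrow>\<^sub>M borel_sigma fell_topology"
      using measurable_near_argmin[OF assms(1) meas0] by (simp add: near_argmin_0)
  next
    fix U :: "'e set set" assume U: "openin fell_topology U"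
    define p where "p = measure N {\<omega> \<in> space N. argmin_set (Z \<omega>) \<in> U}"
    have "\<forall>\<^sub>F \<alpha> in net_filter D le. y < ereal (measure (M \<alpha>) {\<omega> \<in> space (M \<alpha>). ?A \<alpha> \<omega> \<in> U})"
      if y: "y < ereal p" for y
    proof -
      obtain c where c: "y < ereal c" "c < p" using ereal_dense2[OF y] by auto
      \<comment> \<open>Half of the gap \<open>p - c\<close> pays for the convergence of the pairs, half for tightness; tightness
        is used with \<open>\<eta> / 2\<close> to make its bound strict.\<close>
      define \<eta> where "\<eta> = (p - c) / 2"
      have "0 < \<eta> / 2" using c by (simp add: \<eta>_def)
      then obtain K where K: "compact K" and tight: "ereal (1 - \<eta> / 2) \<le>
          Liminf (net_filter D le) (\<lambda>\<alpha>. ereal (measure (M \<alpha>)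
            {\<omega> \<in> space (M \<alpha>). ?A \<alpha> \<omega> \<noteq> {} \<and> ?A \<alpha> \<omega> \<subseteq> K}))"
        using assms(10) by blast
      obtain Q where Q: "openin ?T Q"
        and Q_argmin: "\<And>f. f \<in> lsc_functions \<Longrightarrow> argmin_set f \<in> U \<Longrightarrow>
          argmin_set f \<in> empty_or_singleton_sets \<Longrightarrow> (f, 0) \<in> Q"
        and Q_near: "\<And>f \<epsilon>. (f, \<epsilon>) \<in> Q \<Longrightarrow> near_argmin f \<epsilon> \<noteq> {} \<Longrightarrow> near_argmin f \<epsilon> \<subseteq> K \<Longrightarrow>
          near_argmin f \<epsilon> \<in> U"
        using ex_open_forcing_near_argmin[OF U K] by metis
      have "p \<le> measure N {\<omega> \<in> space N. (Z \<omega>, 0) \<in> Q}"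
        unfolding p_def
        by (intro prob_space.prob_le_if_almost_subset[OF assms(4) assms(11)]
            measurable_borel_sigmaD[OF meas0 Q]) (auto intro: Q_argmin lsc)
      also have "ereal \<dots> \<le> Liminf (net_filter D le) (\<lambda>\<alpha>. ereal (measure (M \<alpha>)
          {\<omega> \<in> space (M \<alpha>). (Z\<^sub>\<alpha> \<alpha> \<omega>, \<epsilon>\<^sub>\<alpha> \<alpha> \<omega>) \<in> Q}))"
        using conv Q by blast
      finally have "\<forall>\<^sub>F \<alpha> in net_filter D le.
          ereal (p - \<eta>) < ereal (measure (M \<alpha>) {\<omega> \<in> space (M \<alpha>). (Z\<^sub>\<alpha> \<alpha> \<omega>, \<epsilon>\<^sub>\<alpha> \<alpha> \<omega>) \<in> Q})"
        using \<open>0 < \<eta> / 2\<close> by (intro less_LiminfD) (auto elim: less_le_trans[rotated])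
      moreover have "\<forall>\<^sub>F \<alpha> in net_filter D le. ereal (1 - \<eta>) < ereal (measure (M \<alpha>)
          {\<omega> \<in> space (M \<alpha>). ?A \<alpha> \<omega> \<noteq> {} \<and> ?A \<alpha> \<omega> \<subseteq> K})"
        using tight \<open>0 < \<eta> / 2\<close> by (intro less_LiminfD) (auto elim: less_le_trans[rotated])
      moreover have "\<forall>\<^sub>F \<alpha> in net_filter D le. \<alpha> \<in> D"
        using assms(2) by (auto simp: eventually_net_filter directed_set_def)
      ultimately show ?thesis
      proof eventually_elim
        case (elim \<alpha>)
        let ?Q = "{\<omega> \<in> space (M \<alpha>). (Z\<^sub>\<alpha> \<alpha> \<omega>, \<epsilon>\<^sub>\<alpha> \<alpha> \<omega>) \<in> Q}"
        let ?C = "{\<omega> \<in> space (M \<alpha>). ?A \<alpha> \<omega> \<noteq> {} \<and> ?A \<alpha> \<omega> \<subseteq> K}"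
        let ?U = "{\<omega> \<in> space (M \<alpha>). ?A \<alpha> \<omega> \<in> U}"
        interpret prob_space "M \<alpha>" using assms(3) elim(3) .
        note events = measurable_borel_sigmaD[OF measA[OF elim(3)]]
        have A_closed: "closed (?A \<alpha> \<omega>)" if "\<omega> \<in> space (M \<alpha>)" for \<omega>
          using measurable_space[OF measA[OF elim(3)] that] by simp
        have "?C = {\<omega> \<in> space (M \<alpha>). ?A \<alpha> \<omega> \<in> {F. closed F \<and> F \<inter> UNIV \<noteq> {}}} -
            {\<omega> \<in> space (M \<alpha>). ?A \<alpha> \<omega> \<in> {F. closed F \<and> F \<inter> - K \<noteq> {}}}"
          using A_closed by blast
        also have "\<dots> \<in> events"
          using K by (intro sets.Diff events openin_fell_hit open_Compl compact_imp_closed) auto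
        finally have "?C \<in> events" .
        then have "prob ?Q + prob ?C - 1 \<le> prob (?Q \<inter> ?C)"
          by (rule prob_Int_ge[OF measurable_borel_sigmaD[OF meas[OF elim(3)] Q]])
        also have "\<dots> \<le> prob ?U"
          using events[OF U] by (intro finite_measure_mono) (auto intro: Q_near)
        moreover have "p - \<eta> < prob ?Q" "1 - \<eta> < prob ?C" using elim(1,2) by simp_all
        moreover have "c = p - \<eta> - \<eta>" by (simp add: \<eta>_def)
        ultimately have "c < prob ?U" by linarith
        then show ?case using c(1) less_trans by fastforce
      qed
    qed
    then show "ereal (measure N {\<omega> \<in> space N. argmin_set (Z \<omega>) \<in> U}) \<le>
        Liminf (net_filter D le) (\<lambda>\<alpha>. ereal (measure (M \<alpha>) {\<omega> \<in> space (M \<alpha>). ?A \<alpha> \<omega> \<in> U}))"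
      unfolding le_Liminf_iff p_def by blast
  qed
qed

end
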